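(* Every connected locally connected $\{K_{1,1,3},K_1+(K_1\cup P_3)\}$-free graph of order at least $3$ is fully cycle extendable.
   Context: All graphs are finite, simple, and undirected. $n(G)$ is the order of $G$; $N_G(u)$ is the (open) neighborhood of $u$ in $G$. $G$ is locally connected if for every vertex $u$ of $G$ the induced subgraph $G[N_G(u)]$ is connected. For disjoint graphs $G,H$, $G\cup H$ is their disjoint union and $G+H$ their join (all edges between $G$ and $H$ are added to $G\cup H$); $K_n$ and $P_n$ are the complete graph and the path of order $n$, $\bar{G}$ is the complement of $G$, and $K_{1,1,3}=K_1+K_1+\bar{K}_3$. For a set ${\cal F}$ of graphs, a graph is ${\cal F}$-free if it contains no graph in ${\cal F}$ as an induced subgraph (up to isomorphism). A cycle $C$ in $G$ is extendable if $G$ contains a cycle $C'$ of order $n(C)+1$ with $V(C)\subseteq V(C')$. $G$ is fully cycle extendable if every vertex of $G$ lies on a triangle and every cycle in $G$ of order less than $n(G)$ is extendable. *)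

theory Defs
  imports "Graph_Theory.Graph_Theory"
begin

text \<open>
  A finite simple undirected graph is a \<^const>\<open>pair_graph\<close>: a finite vertex set together with
  an irreflexive symmetric adjacency relation on it.
\<close>

definition complete_graph :: "nat \<Rightarrow> nat pair_pre_digraph" where
  "complete_graph n = \<lparr> pverts = {..<n}, parcs = {(i, j). i < n \<and> j < n \<and> i \<noteq> j} \<rparr>"

definition path_graph :: "nat \<Rightarrow> nat pair_pre_digraph" where
  "path_graph n = \<lparr> pverts = {..<n}, parcs = {(i, j). i < n \<and> j < n \<and> (j = Suc i \<or> i = Suc j)} \<rparr>"

definition complement_graph :: "'a pair_pre_digraph \<Rightarrow> 'a pair_pre_digraph" where
  "complement_graph G = \<lparr> pverts = pverts G,
     parcs = {(u, v). u \<in> pverts G \<and> v \<in> pverts G \<and> u \<noteq> v \<and> (u, v) \<notin> parcs G} \<rparr>"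

definition disjoint_union_graph ::
  "'a pair_pre_digraph \<Rightarrow> 'b pair_pre_digraph \<Rightarrow> ('a + 'b) pair_pre_digraph" where
  "disjoint_union_graph G H = \<lparr> pverts = pverts G <+> pverts H,
     parcs = map_prod Inl Inl ` parcs G \<union> map_prod Inr Inr ` parcs H \<rparr>"

definition join_graph ::
  "'a pair_pre_digraph \<Rightarrow> 'b pair_pre_digraph \<Rightarrow> ('a + 'b) pair_pre_digraph" where
  "join_graph G H = \<lparr> pverts = pverts G <+> pverts H,
     parcs = parcs (disjoint_union_graph G H)
       \<union> (Inl ` pverts G) \<times> (Inr ` pverts H) \<union> (Inr ` pverts H) \<times> (Inl ` pverts G) \<rparr>"

text \<open>
  The join is associative up to isomorphism only. Bracketing to the right makes the two
  forbidden graphs below have the same type, so that they can be put into one set.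
\<close>

definition K113 :: "(nat + (nat + nat)) pair_pre_digraph" where
  "K113 = join_graph (complete_graph 1)
     (join_graph (complete_graph 1) (complement_graph (complete_graph 3)))"

definition K1_join_K1_union_P3 :: "(nat + (nat + nat)) pair_pre_digraph" where
  "K1_join_K1_union_P3 = join_graph (complete_graph 1)
     (disjoint_union_graph (complete_graph 1) (path_graph 3))"

definition induced_free :: "'b pair_pre_digraph set \<Rightarrow> 'a pair_pre_digraph \<Rightarrow> bool" where
  "induced_free \<F> G \<longleftrightarrow>
     \<not> (\<exists>F\<in>\<F>. \<exists>H. induced_subgraph H (with_proj G) \<and> digraph_iso (with_proj F) H)"

definition neighborhood :: "'a pair_pre_digraph \<Rightarrow> 'a \<Rightarrow> 'a set" where
  "neighborhood G u = {v. (u, v) \<in> parcs G}"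

text \<open>
  \<^const>\<open>Digraph_Component.connected\<close> is false for the graph without vertices, so a graph with
  an isolated vertex is not locally connected. For a connected graph with at least two vertices
  all neighborhoods are nonempty, and the convention is irrelevant.
\<close>

definition locally_connected :: "'a pair_pre_digraph \<Rightarrow> bool" where
  "locally_connected G \<longleftrightarrow>
     (\<forall>u\<in>pverts G. Digraph_Component.connected (with_proj G \<restriction> neighborhood G u))"

text \<open>
  Cycles are closed arc walks in the symmetric digraph. \<^const>\<open>pre_digraph.cycle\<close> also admits
  going back and forth along a single edge; cycles of an undirected graph have length at least 3.
  A cycle here carries a starting point and an orientation, but only its vertex set matters below.
\<close>

definition graph_cycle :: "'a pair_pre_digraph \<Rightarrow> ('a \<times> 'a) awalk \<Rightarrow> bool" where
  "graph_cycle G C \<longleftrightarrow> pre_digraph.cycle (with_proj G) C \<and> 3 \<le> length C"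

definition cycle_verts :: "('a \<times> 'a) awalk \<Rightarrow> 'a set" where
  "cycle_verts C = fst ` set C"

definition extendable :: "'a pair_pre_digraph \<Rightarrow> ('a \<times> 'a) awalk \<Rightarrow> bool" where
  "extendable G C \<longleftrightarrow> (\<exists>C'. graph_cycle G C' \<and>
     card (cycle_verts C') = card (cycle_verts C) + 1 \<and> cycle_verts C \<subseteq> cycle_verts C')"

definition fully_cycle_extendable :: "'a pair_pre_digraph \<Rightarrow> bool" where
  "fully_cycle_extendable G \<longleftrightarrow>
     (\<forall>u\<in>pverts G. \<exists>T. graph_cycle G T \<and> card (cycle_verts T) = 3 \<and> u \<in> cycle_verts T) \<and>
     (\<forall>C. graph_cycle G C \<and> card (cycle_verts C) < card (pverts G) \<longrightarrow> extendable G C)"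

end

theory Submission
  imports Defs
begin

text \<open>
  The two forbidden graphs say that every neighborhood \<open>N(u)\<close> is free of \<open>K\<^sub>1\<^sub>,\<^sub>3\<close> and of
  \<open>K\<^sub>1 \<union> P\<^sub>3\<close>. Given independent \<open>a, b, c \<in> N(u)\<close>, a further vertex of \<open>N(u)\<close> adjacent to all three
  gives the former and one adjacent to exactly two of them the latter; hence a neighbor of \<open>a\<close> can
  replace \<open>a\<close> in the triple, and \<open>a\<close> is never joined to \<open>b\<close> inside \<open>N(u)\<close>. So local connectedness
  makes the graph claw-free.

  In a connected locally connected claw-free graph let \<open>C\<close> be a nonextendable cycle and \<open>ux\<close> an edge
  leaving it. In \<open>N(u)\<close> the vertices not adjacent to \<open>x\<close> form a clique containing the two cycle
  neighbors of \<open>u\<close>, and some edge \<open>yz\<close> joins \<open>N(x)\<close> to this clique. Then \<open>y\<close> and \<open>z\<close> lie on \<open>C\<close>,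
  \<open>z\<close> is adjacent to the cycle neighbors of \<open>u\<close> and, symmetrically, of \<open>y\<close>, and claw-freeness at
  \<open>z\<close> always leaves a way to reroute \<open>C\<close> through \<open>u x y\<close>.
\<close>

section \<open>Cycles as vertex lists\<close>

definition cyclic :: "('a \<Rightarrow> 'a \<Rightarrow> bool) \<Rightarrow> 'a list \<Rightarrow> bool" where
  "cyclic E vs \<longleftrightarrow> 3 \<le> length vs \<and> distinct vs \<and> successively E vs \<and> E (last vs) (hd vs)"

text \<open>Stated for the vertex set alone, so that a cycle may be rotated or reversed
  freely.\<close>

definition extends :: "('a \<Rightarrow> 'a \<Rightarrow> bool) \<Rightarrow> 'a set \<Rightarrow> bool" where
  "extends E S \<longleftrightarrow> (\<exists>ws. cyclic E ws \<and> card (set ws) = Suc (card S) \<and> S \<subseteq> set ws)"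

lemma cyclic_rotate:
  assumes "cyclic E (xs @ ys)"
  shows "cyclic E (ys @ xs)"
  using assms
  by (cases "xs = []"; cases "ys = []") (auto simp: cyclic_def successively_append_iff)

lemma cyclic_rotate_to:
  assumes "cyclic E vs" "u \<in> set vs"
  obtains P where "cyclic E (u # P)" "set (u # P) = set vs"
proof -
  obtain xs ys where "vs = xs @ u # ys"
    using assms(2) by (auto dest: split_list)
  with assms(1) have "cyclic E (u # ys @ xs)" "set (u # ys @ xs) = set vs"
    using cyclic_rotate[of E xs "u # ys"] by auto
  then show thesis by (rule that)
qed

lemma cyclic_subset:
  assumes "\<And>x y. E x y \<Longrightarrow> x \<in> V" "cyclic E vs"
  shows "set vs \<subseteq> V"
proof
  fix v assume "v \<in> set vs"
  then obtain P where P: "cyclic E (v # P)"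
    using assms(2) cyclic_rotate_to by metis
  then show "v \<in> V"
    using assms(1) by (cases P) (auto simp: cyclic_def)
qed

lemma extendsI:
  assumes "cyclic E ws" "set ws = insert x S" "x \<notin> S" "finite S"
  shows "extends E S"
  using assms by (auto simp: extends_def)

section \<open>Extending cycles in locally connected claw-free graphs\<close>

locale sym_irrefl =
  fixes E :: "'a \<Rightarrow> 'a \<Rightarrow> bool"
  assumes sym: "E x y \<Longrightarrow> E y x"
    and irrefl: "\<not> E x x"
begin

lemma adj_commute: "E x y \<longleftrightarrow> E y x"
  using sym by blast

lemma successively_rev_iff: "successively E (rev xs) \<longleftrightarrow> successively E xs"
proof -
  have "(\<lambda>x y. E y x) = E"
    using sym by blast
  with successively_rev[of E xs] show ?thesis by (simp only:)
qed

lemma cyclic_reverse: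
  assumes "cyclic E (u # P)"
  shows "cyclic E (u # rev P)"
  using assms
  by (cases "P = []")
    (auto simp: adj_commute cyclic_def successively_Cons successively_rev_iff hd_rev last_rev simp del: successively_rev)

lemma extends_insert:
  assumes "cyclic E (u # P)" "x \<notin> set (u # P)" "E u x" "E x (hd P)"
  shows "extends E (set (u # P))"
proof (rule extendsI[of E "u # x # P" x])
  show "cyclic E (u # x # P)"
    using assms by (auto simp: cyclic_def successively_Cons split: if_splits)
qed (use assms in auto)

text \<open>The cycle is \<open>u A z B y D\<close>; the new cycle passes through \<open>x\<close> between \<open>u\<close> and \<open>y\<close>.\<close>

lemma extends_reroute:
  assumes cyc: "cyclic E (u # A @ z # B @ y # D)" and x: "x \<notin> set (u # A @ z # B @ y # D)"
    and ne: "A \<noteq> []" "B \<noteq> []" "D \<noteq> []"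
    and ed: "E u x" "E x y" "E z u" "E z y"
      "E z (hd A)" "E z (last D)" "E z (hd D)" "E z (last B)" "E (hd A) (last D)" "E (hd D) (last B)"
    and alt: "E (last A) (hd B) \<or>
      ((E u (last A) \<or> E u (hd B)) \<and> (E y (last A) \<or> E y (hd B)))"
  shows "extends E (set (u # A @ z # B @ y # D))"
proof -
  note S = cyclic_def successively_Cons successively_append_iff successively_rev_iff hd_rev last_rev
  note all = cyc x ne ed
  \<comment> \<open>In each of the four new cycles \<open>y\<close> is bypassed by the edge between
    \<open>last B\<close> and \<open>hd D\<close> and reinserted beside \<open>x\<close>; the cases
    differ in how the blocks are then linked.\<close>
  consider "E (last A) (hd B)" | "E u (last A)" | "E y (hd B)" | "E u (hd B)" "E y (last A)"
    using alt by blast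
  then show ?thesis
  proof cases
    case 1
    show ?thesis
    proof (rule extendsI[of E "u # x # y # z # A @ B @ D" x])
      show "cyclic E (u # x # y # z # A @ B @ D)"
        using all 1 by (auto simp: S adj_commute simp del: successively_rev)
    qed (use x in auto)
  next
    case 2
    show ?thesis
    proof (rule extendsI[of E "u # rev A @ rev D @ rev B @ [z, y, x]" x])
      show "cyclic E (u # rev A @ rev D @ rev B @ [z, y, x])"
        using all 2 by (auto simp: S adj_commute simp del: successively_rev)
    qed (use x in auto)
  next
    case 3
    show ?thesis
    proof (rule extendsI[of E "u # x # y # B @ D @ A @ [z]" x])
      show "cyclic E (u # x # y # B @ D @ A @ [z])"
        using all 3 by (auto simp: S adj_commute simp del: successively_rev)
    qed (use x in auto)
  next
    case 4
    show ?thesis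
    proof (rule extendsI[of E "x # u # B @ D @ z # A @ [y]" x])
      show "cyclic E (x # u # B @ D @ z # A @ [y])"
        using all 4 by (auto simp: S adj_commute simp del: successively_rev)
    qed (use x in auto)
  qed
qed

end

locale claw_free = sym_irrefl +
  assumes claw_free: "E u a \<Longrightarrow> E u b \<Longrightarrow> E u c \<Longrightarrow> a \<noteq> b \<Longrightarrow> a \<noteq> c \<Longrightarrow> b \<noteq> c \<Longrightarrow>
    E a b \<or> E a c \<or> E b c"
begin

text \<open>\<open>hd P\<close> and \<open>last P\<close> are the cycle neighbors of
  \<open>u\<close>. If \<open>x\<close> were adjacent to one of them, it could be inserted next to
  \<open>u\<close>; so they must be adjacent, or \<open>u\<close> would centre a claw on them and
  \<open>x\<close>.\<close>

lemma outside_neighbor: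
  assumes "cyclic E (u # P)" "x \<notin> set (u # P)" "E u x" "\<not> extends E (set (u # P))"
  shows "\<not> E x (hd P)" "\<not> E x (last P)" "E (hd P) (last P)"
proof -
  show 1: "\<not> E x (hd P)"
    using extends_insert assms by blast
  show 2: "\<not> E x (last P)"
    using extends_insert[of u "rev P" x] cyclic_reverse assms by (auto simp: hd_rev)
  \<comment> \<open>A cycle has at least three vertices, so \<open>hd P\<close> and
    \<open>last P\<close> are distinct.\<close>
  from assms(1) obtain p Q where P: "P = p # Q" "Q \<noteq> []"
    by (cases P) (auto simp: cyclic_def Suc_le_eq)
  with assms have "E u (hd P)" "E u (last P)" "hd P \<noteq> last P" "hd P \<noteq> x" "last P \<noteq> x"
    by (auto simp: cyclic_def successively_Cons adj_commute)
  with claw_free[of u x "hd P" "last P"] assms(3) 1 2 show "E (hd P) (last P)"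
    by auto
qed

text \<open>If the cycle is not extendable, the cycle neighbors of \<open>y\<close> are adjacent by
  \<open>outside_neighbor\<close>, so \<open>y\<close> can be cut out and put back after
  \<open>x\<close>, between \<open>u\<close> and \<open>hd P\<close>.\<close>

lemma extends_bypass_hd:
  assumes cyc: "cyclic E (u # P)" and x: "x \<notin> set (u # P)" and y: "y \<in> set P"
    and ed: "E u x" "E x y" "E y (hd P)"
  shows "extends E (set (u # P))"
proof (rule ccontr)
  assume not_ext: "\<not> extends E (set (u # P))"
  obtain P1 P2 where P: "P = P1 @ y # P2"
    using y by (auto dest: split_list)
  have "\<not> E x (hd P)" "\<not> E x (last P)"
    using outside_neighbor[OF cyc x ed(1) not_ext] by auto
  \<comment> \<open>\<open>x\<close> is adjacent to \<open>y\<close> but to neither end of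
    \<open>P\<close>.\<close>
  with ed P have ne: "P1 \<noteq> []" "P2 \<noteq> []" by auto
  have "cyclic E (y # P2 @ u # P1)"
    using cyclic_rotate[of E "u # P1" "y # P2"] cyc P by auto
  moreover have set_eq: "set (y # P2 @ u # P1) = set (u # P)"
    using P by auto
  ultimately have link: "E (hd P2) (last P1)"
    using outside_neighbor(3)[of y "P2 @ u # P1" x] x sym[OF ed(2)] not_ext ne
    by (metis hd_append2 last.simps last_appendR list.distinct(1))
  have "extends E (set (u # P))"
  proof (rule extendsI[of E "u # x # y # P1 @ P2" x])
    show "cyclic E (u # x # y # P1 @ P2)"
      using cyc x ed P ne sym[OF link]
      by (auto simp: cyclic_def successively_Cons successively_append_iff)
  qed (use x P in auto)
  with not_ext show False ..
qed

lemma extends_bypass: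
  assumes "cyclic E (u # P)" "x \<notin> set (u # P)" "y \<in> set P"
    and "E u x" "E x y" "E y (hd P) \<or> E y (last P)"
  shows "extends E (set (u # P))"
  using extends_bypass_hd[of u P x y] extends_bypass_hd[of u "rev P" x y] cyclic_reverse[of u P] assms
  by (auto simp: hd_rev)

text \<open>
  Since \<open>E\<close> is claw-free, the neighbors of \<open>u\<close> not adjacent to \<open>x\<close> form a clique, and so do those
  of \<open>y\<close>. Hence \<open>z\<close> is adjacent to all four cycle neighbors of \<open>u\<close> and \<open>y\<close>.
\<close>

lemma extends_chord_before:
  assumes cyc: "cyclic E (u # A @ z # C)" and y: "y \<in> set C"
    and x: "x \<notin> set (u # A @ z # C)"
    and ed: "E u x" "E x y" "E u y" "E u z" "E y z" "\<not> E x z"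
  shows "extends E (set (u # A @ z # C))"
proof (rule ccontr)
  let ?S = "set (u # A @ z # C)"
  assume not_ext: "\<not> extends E ?S"
  obtain B D where C: "C = B @ y # D"
    using y by (auto dest: split_list)
  define P where "P = A @ z # C"
  have cycP: "cyclic E (u # P)" and SP: "?S = set (u # P)"
    using cyc P_def by auto
  have xP: "x \<notin> set (u # P)" and yP: "y \<in> set P"
    using x C by (auto simp: P_def)
  \<comment> \<open>The same cycle read from \<open>y\<close>: the ends of \<open>Q\<close> are the
    cycle neighbors of \<open>y\<close>.\<close>
  define Q where "Q = D @ u # A @ z # B"
  have cycQ: "cyclic E (y # Q)"
    using cyclic_rotate[of E "u # A @ z # B" "y # D"] cyc C Q_def by simp
  have SQ: "?S = set (y # Q)"
    using C by (auto simp: Q_def)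
  have xQ: "x \<notin> set (y # Q)" and uQ: "u \<in> set Q"
    using x SQ by (auto simp: Q_def)
  note nu = outside_neighbor[OF cycP xP ed(1) not_ext[unfolded SP]]
  note ny = outside_neighbor[OF cycQ xQ sym[OF ed(2)] not_ext[unfolded SQ]]
  have byP: "\<not> E y (hd P)" "\<not> E y (last P)"
    using extends_bypass[OF cycP xP yP ed(1,2)] not_ext SP by auto
  have byQ: "\<not> E u (hd Q)" "\<not> E u (last Q)"
    using extends_bypass[OF cycQ xQ uQ sym[OF ed(2)] sym[OF ed(1)]] not_ext SQ by auto
  \<comment> \<open>With \<open>A\<close> empty, \<open>z\<close> would be a cycle neighbor of
    \<open>u\<close> adjacent to \<open>y\<close>; with \<open>B\<close> empty, one of
    \<open>y\<close> adjacent to \<open>u\<close>; with \<open>D\<close> empty, \<open>y\<close>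
    would be one of \<open>u\<close> adjacent to \<open>x\<close>.\<close>
  have ne: "A \<noteq> []" "D \<noteq> []" "B \<noteq> []"
    using byP(1) byQ nu(2) ed(2-5) unfolding P_def Q_def C by auto
  then have ends: "hd P = hd A" "last P = last D" "hd Q = hd D" "last Q = last B"
    by (auto simp: P_def Q_def C)
  note S = cyclic_def successively_Cons successively_append_iff
  have E1: "E u (hd A)" "E u (last D)" "E y (hd D)" "E y (last B)" "E z (last A)" "E z (hd B)"
    using cyc ne unfolding C by (auto simp: S adj_commute)
  have dist: "z \<noteq> hd A" "z \<noteq> last D" "z \<noteq> hd D" "z \<noteq> last B"
    "u \<noteq> last A" "u \<noteq> hd B" "y \<noteq> last A" "y \<noteq> hd B"
    "x \<noteq> hd A" "x \<noteq> last D" "x \<noteq> hd D" "x \<noteq> last B" "x \<noteq> z"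
    using cyc x ne unfolding C by (auto simp: cyclic_def)
  have "set A \<inter> set B = {}"
    using cyc C by (auto simp: cyclic_def)
  then have AB: "last A \<noteq> hd B"
    using last_in_set[OF ne(1)] hd_in_set[OF ne(3)] by auto
  have yx: "E y x" and zu: "E z u" and zy: "E z y"
    using ed sym by auto
  have "E z (hd A)"
    using claw_free[of u x z "hd A"] ed(1,4,6) E1(1) nu(1) dist ends(1) by metis
  moreover have "E z (last D)"
    using claw_free[of u x z "last D"] ed(1,4,6) E1(2) nu(2) dist ends(2) by metis
  moreover have "E z (hd D)"
    using claw_free[of y x z "hd D"] yx ed(5,6) E1(3) ny(1) dist ends(3) by metis
  moreover have "E z (last B)"
    using claw_free[of y x z "last B"] yx ed(5,6) E1(4) ny(2) dist ends(4) by metis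
  \<comment> \<open>The stars at \<open>z\<close> with leaves \<open>last A\<close>,
    \<open>hd B\<close> and either \<open>u\<close> or \<open>y\<close> are not claws; together this
    is \<open>alt\<close> of \<open>extends_reroute\<close>.\<close>
  moreover have "E (last A) (hd B) \<or> E u (last A) \<or> E u (hd B)"
    using claw_free[OF zu E1(5,6)] dist AB by blast
  moreover have "E (last A) (hd B) \<or> E y (last A) \<or> E y (hd B)"
    using claw_free[OF zy E1(5,6)] dist AB by blast
  ultimately have "extends E ?S"
    unfolding C using cyc x ne ed(1,2) zu zy nu(3) ny(3) ends
    by (intro extends_reroute) (auto simp: C)
  with not_ext show False ..
qed

end

text \<open>\<open>local_edge\<close> is connectedness of each neighborhood in cut form.\<close>

locale locally_connected_claw_free = claw_free +
  assumes local_edge: "E u a \<Longrightarrow> E u b \<Longrightarrow> a \<in> S \<Longrightarrow> b \<notin> S \<Longrightarrow>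
    \<exists>y z. E u y \<and> E u z \<and> y \<in> S \<and> z \<notin> S \<and> E y z"
begin

theorem cyclic_extends:
  assumes cyc: "cyclic E vs" and u: "u \<in> set vs" and x: "x \<notin> set vs" and ux: "E u x"
  shows "extends E (set vs)"
proof (rule ccontr)
  assume not_ext: "\<not> extends E (set vs)"
  obtain P where P: "cyclic E (u # P)" "set (u # P) = set vs"
    using cyclic_rotate_to[OF cyc u] .
  have nu: "\<not> E t (hd P)" "\<not> E t (last P)" if "E u t" "t \<notin> set vs" for t
    using outside_neighbor[OF P(1), of t] that not_ext P by auto
  have not_bypass: "\<not> E y (hd P)" if "E u t" "t \<notin> set vs" "E t y" "y \<in> set P" for t y
    using extends_bypass[OF P(1), of t y] that not_ext P by auto
  have Pne: "P \<noteq> []" using P by (auto simp: cyclic_def)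
  then have uh: "E u (hd P)" "hd P \<in> set P" using P by (auto simp: cyclic_def successively_Cons)
  have "hd P \<noteq> x" using uh x P by auto
  \<comment> \<open>The cut is the closed neighborhood of \<open>x\<close>, which contains
    \<open>x\<close> but not \<open>hd P\<close>. Since \<open>z\<close> is not adjacent to
    \<open>x\<close>, the end \<open>y\<close> differs from \<open>x\<close>.\<close>
  then obtain y z where yz: "E u y" "E u z" "y = x \<or> E x y" "z \<noteq> x" "\<not> E x z" "E y z"
    using local_edge[of u x "hd P" "{t. t = x \<or> E x t}"] ux uh(1) nu(1)[OF ux x] by auto
  from yz have xy: "E x y" by blast
  \<comment> \<open>Otherwise \<open>u\<close> would centre a claw with leaves \<open>x\<close>,
    \<open>z\<close>, \<open>hd P\<close>.\<close>
  have z_hd: "z = hd P \<or> E z (hd P)"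
    using claw_free[of u x z "hd P"] ux yz uh nu(1)[OF ux x] \<open>hd P \<noteq> x\<close> by auto
  have "hd P \<in> set vs" using uh P by auto
  have zC: "z \<in> set vs" using z_hd nu(1)[OF yz(2)] \<open>hd P \<in> set vs\<close> by blast
  have zP: "z \<in> set P" using zC P(2) yz(2) irrefl by (metis set_ConsD)
  \<comment> \<open>An outside \<open>y\<close> could take the role of \<open>x\<close>: it would be
    adjacent to \<open>hd P\<close> itself or to a cycle vertex \<open>z\<close> adjacent to
    \<open>hd P\<close>.\<close>
  have yC: "y \<in> set vs"
  proof (rule ccontr)
    assume "y \<notin> set vs"
    then show False
      using not_bypass[of y z] nu(1)[of y] yz z_hd zP by auto
  qed
  have yP: "y \<in> set P" using yC P(2) yz(1) irrefl by (metis set_ConsD)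
  have yz_ne: "y \<noteq> z" using yz irrefl by auto
  \<comment> \<open>Stated for any traversal from \<open>u\<close> meeting \<open>z\<close> before
    \<open>y\<close>; reversal covers the other order.\<close>
  have key: False if cycR: "cyclic E (u # R)" and R: "R = A @ z # C" "y \<in> set C" "set R = set P" for R A C
    using extends_chord_before[of u A z C y x] that x P ux xy yz not_ext by auto
  obtain A C where AC: "P = A @ z # C"
    using zP by (auto dest: split_list)
  show False
  proof (cases "y \<in> set C")
    case True
    with key[OF P(1) AC] show False by simp
  next
    case False
    with yP yz_ne AC have "y \<in> set (rev A)" by auto
    with key[OF cyclic_reverse[OF P(1)], of "rev C" "rev A"] AC show False by auto
  qed
qed

end

section \<open>Forbidden induced subgraphs\<close>

text \<open>A map that is injective and both preserves and reflects arcs is an isomorphism onto the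
  subgraph induced on its image.\<close>

lemma not_induced_free:
  assumes "wf_digraph (with_proj G)" "wf_digraph (with_proj F)" "F \<in> \<F>"
    and inj: "inj_on f (pverts F)" and verts: "f ` pverts F \<subseteq> pverts G"
    and arcs: "\<And>i j. i \<in> pverts F \<Longrightarrow> j \<in> pverts F \<Longrightarrow> (i, j) \<in> parcs F \<longleftrightarrow> (f i, f j) \<in> parcs G"
  shows "\<not> induced_free \<F> G"
proof -
  interpret F: pair_wf_digraph F using assms(2) wf_digraph_wp_iff by blast
  define h where "h = \<lparr> iso_verts = f, iso_arcs = map_prod f f, iso_head = snd, iso_tail = fst \<rparr>"
  let ?H = "with_proj G \<restriction> (f ` pverts F)"
  have "induced_subgraph ?H (with_proj G)"
    using assms(1) verts by (simp add: wf_digraph.induced_induce)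
  moreover have "pre_digraph.digraph_isomorphism (with_proj F) h"
    using assms(2) inj F.wellformed'
    by (auto simp: pre_digraph.digraph_isomorphism_def h_def inj_on_def)
  moreover have "map_prod f f ` parcs F = {e \<in> parcs G. fst e \<in> f ` pverts F \<and> snd e \<in> f ` pverts F}"
    (is "?L = ?R")
  proof
    show "?L \<subseteq> ?R"
    proof
      fix e assume "e \<in> ?L"
      then obtain i j where "e = (f i, f j)" "(i, j) \<in> parcs F" by auto
      then show "e \<in> ?R"
        using arcs[of i j] F.wellformed'[of i j] by simp
    qed
    show "?R \<subseteq> ?L"
    proof
      fix e assume "e \<in> ?R"
      then obtain i j where e: "e = (f i, f j)" "i \<in> pverts F" "j \<in> pverts F" "e \<in> parcs G"
        by (cases e) auto
      then have "(i, j) \<in> parcs F"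
        using arcs[of i j] by simp
      with e(1) show "e \<in> ?L"
        by (metis image_eqI map_prod_simp)
    qed
  qed
  then have "?H = app_iso h (with_proj F)"
    by (simp add: app_iso_def h_def induce_subgraph_def)
  ultimately show ?thesis
    using assms(3) unfolding induced_free_def digraph_iso_def by blast
qed

text \<open>Connectedness is reachability in the symmetric closure. A walk there from
  \<open>a\<close> to \<open>b\<close> leaves \<open>S\<close>, possibly against an arc of
  \<open>H\<close>, hence the two orientations.\<close>

lemma connected_crossing_arc:
  assumes "Digraph_Component.connected H" "a \<in> verts H" "b \<in> verts H" "a \<in> S" "b \<notin> S"
  shows "\<exists>e\<in>arcs H. tail H e \<in> S \<and> head H e \<notin> S \<or> head H e \<in> S \<and> tail H e \<notin> S"
proof -
  let ?M = "with_proj (mk_symmetric H)"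
  have "a \<rightarrow>\<^sup>*\<^bsub>?M\<^esub> b"
    using assms(1-3) by (auto simp: Digraph_Component.connected_def strongly_connected_def mk_symmetric_def)
  then have "(a, b) \<in> (arcs_ends ?M)\<^sup>*"
    by (rule reachable_rtranclI)
  then have "\<exists>x y. (x, y) \<in> arcs_ends ?M \<and> x \<in> S \<and> y \<notin> S"
    using assms(4,5) by (induction rule: rtrancl_induct) auto
  then show ?thesis
    by (auto simp: mk_symmetric_def)
qed

lemma K113_embedding:
  fixes G :: "'a pair_pre_digraph"
  assumes "wf_digraph (with_proj G)" "K113 \<in> \<F>"
    and "distinct [u, v, a, b, c]" "{u, v, a, b, c} \<subseteq> pverts G"
    and sym: "\<And>s t. (s, t) \<in> parcs G \<longleftrightarrow> (t, s) \<in> parcs G" and irr: "\<And>s. (s, s) \<notin> parcs G"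
    and "(u, v) \<in> parcs G" "\<forall>t\<in>{a, b, c}. (u, t) \<in> parcs G \<and> (v, t) \<in> parcs G"
    and "(a, b) \<notin> parcs G" "(a, c) \<notin> parcs G" "(b, c) \<notin> parcs G"
  shows "\<not> induced_free \<F> G"
proof -
  define f :: "nat + (nat + nat) \<Rightarrow> 'a" where
    "f = case_sum (\<lambda>_. u) (case_sum (\<lambda>_. v) (\<lambda>i. if i = 0 then a else if i = 1 then b else c))"
  have V: "pverts K113 = {Inl 0, Inr (Inl 0), Inr (Inr 0), Inr (Inr 1), Inr (Inr 2)}"
    by (auto simp: K113_def join_graph_def complement_graph_def complete_graph_def)
  \<comment> \<open>The nested joins flattened: only pairs within the independent triple are
    missing.\<close>
  have A: "parcs K113 = {(s, t). s \<in> pverts K113 \<and> t \<in> pverts K113 \<and> s \<noteq> t \<and>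
      \<not> (s \<in> range (Inr \<circ> Inr) \<and> t \<in> range (Inr \<circ> Inr))}"
    by (auto simp: K113_def join_graph_def complement_graph_def complete_graph_def
        disjoint_union_graph_def)
  show ?thesis
  proof (rule not_induced_free[OF assms(1) _ assms(2)])
    show "wf_digraph (with_proj K113)"
      by unfold_locales (auto simp: A)
    show "inj_on f (pverts K113)"
      using assms(3) by (auto simp: V f_def)
    show "f ` pverts K113 \<subseteq> pverts G"
      using assms(4) by (auto simp: V f_def)
    show "(i, j) \<in> parcs K113 \<longleftrightarrow> (f i, f j) \<in> parcs G"
      if "i \<in> pverts K113" "j \<in> pverts K113" for i j
      using that assms(3,7-) sym irr unfolding A by (auto simp: V f_def)
  qed
qed

text \<open>\<open>u\<close> is the dominating vertex, \<open>c\<close> the isolated one of the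
  rest, and \<open>a\<close>, \<open>v\<close>, \<open>b\<close> the path in this order.\<close>

lemma K1_join_K1_union_P3_embedding:
  fixes G :: "'a pair_pre_digraph"
  assumes "wf_digraph (with_proj G)" "K1_join_K1_union_P3 \<in> \<F>"
    and "distinct [u, c, a, v, b]" "{u, c, a, v, b} \<subseteq> pverts G"
    and sym: "\<And>s t. (s, t) \<in> parcs G \<longleftrightarrow> (t, s) \<in> parcs G" and irr: "\<And>s. (s, s) \<notin> parcs G"
    and "\<forall>t\<in>{c, a, v, b}. (u, t) \<in> parcs G" "(a, v) \<in> parcs G" "(v, b) \<in> parcs G"
    and "(a, b) \<notin> parcs G" "(a, c) \<notin> parcs G" "(b, c) \<notin> parcs G" "(v, c) \<notin> parcs G"
  shows "\<not> induced_free \<F> G"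
proof -
  let ?F = K1_join_K1_union_P3
  define f :: "nat + (nat + nat) \<Rightarrow> 'a" where
    "f = case_sum (\<lambda>_. u) (case_sum (\<lambda>_. c) (\<lambda>i. if i = 0 then a else if i = 1 then v else b))"
  have V: "pverts ?F = {Inl 0, Inr (Inl 0), Inr (Inr 0), Inr (Inr 1), Inr (Inr 2)}"
    by (auto simp: K1_join_K1_union_P3_def join_graph_def complete_graph_def
        disjoint_union_graph_def path_graph_def)
  have A: "parcs ?F = {(s, t). s \<in> pverts ?F \<and> t \<in> pverts ?F \<and>
      ((s = Inl 0) \<noteq> (t = Inl 0) \<or>
      (\<exists>i j. s = Inr (Inr i) \<and> t = Inr (Inr j) \<and> (j = Suc i \<or> i = Suc j)))}"
    by (auto simp: K1_join_K1_union_P3_def join_graph_def complete_graph_def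
        disjoint_union_graph_def path_graph_def)
  show ?thesis
  proof (rule not_induced_free[OF assms(1) _ assms(2)])
    show "wf_digraph (with_proj ?F)"
      by unfold_locales (auto simp: A)
    show "inj_on f (pverts ?F)"
      using assms(3) by (auto simp: V f_def)
    show "f ` pverts ?F \<subseteq> pverts G"
      using assms(4) by (auto simp: V f_def)
    show "(i, j) \<in> parcs ?F \<longleftrightarrow> (f i, f j) \<in> parcs G"
      if "i \<in> pverts ?F" "j \<in> pverts ?F" for i j
      using that assms(3,7-) sym irr unfolding A by (auto simp: V f_def)
  qed
qed

section \<open>Cycles as arc walks\<close>

lemma pcas_imp_successively:
  assumes "pcas u p v" "set p \<subseteq> R"
  shows "successively (\<lambda>x y. (x, y) \<in> R) (map fst p @ [v])" "hd (map fst p @ [v]) = u"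
  using assms by (induction p arbitrary: u) (auto simp: successively_Cons)

lemma pawalk_verts_conv:
  "pcas u p v \<Longrightarrow> pawalk_verts u p = map fst p @ [v]"
  by (induction p arbitrary: u) auto

lemma graph_cycle_imp_cyclic:
  assumes "graph_cycle G C"
  shows "cyclic (\<lambda>x y. (x, y) \<in> parcs G) (map fst C)"
proof -
  let ?E = "\<lambda>x y. (x, y) \<in> parcs G"
  obtain u where C: "pcas u C u" "set C \<subseteq> parcs G" "distinct (tl (pawalk_verts u C))" "3 \<le> length C"
    using assms unfolding graph_cycle_def pre_digraph.cycle_def pre_digraph.awalk_def
    by (auto simp: cas_with_proj_eq awalk_verts_with_proj_eq)
  have suc: "successively ?E (map fst C @ [u])" and hd: "hd (map fst C @ [u]) = u"
    using pcas_imp_successively[OF C(1,2)] by auto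
  \<comment> \<open>The start \<open>u\<close> recurs at the end, so \<open>tl\<close> still lists
    every vertex of the cycle once.\<close>
  have "distinct (tl (map fst C @ [u]))"
    using C(3) pawalk_verts_conv[OF C(1)] by simp
  moreover obtain e C' where C': "C = e # C'" using C(4) by (cases C) auto
  ultimately have "distinct (map fst C)" using hd by auto
  moreover have "?E (last (map fst C)) (hd (map fst C))"
    using suc hd C' by (auto simp: successively_Cons successively_append_iff last_map)
  moreover have "successively ?E (map fst C)"
    using suc by (simp only: successively_append_iff)
  ultimately show ?thesis
    using C(4) by (simp add: cyclic_def)
qed

text \<open>Pairing each vertex with its successor gives the arc walk, closed if
  \<open>w = hd vs\<close>. The start \<open>hd (vs @ [w])\<close> also covers the empty
  list.\<close>

lemma pcas_zip:
  "pcas (hd (vs @ [w])) (zip vs (tl (vs @ [w]))) w"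
proof (induction vs)
  case (Cons a vs)
  then show ?case by (cases vs) auto
qed simp

lemma successively_imp_zip_subset:
  assumes "successively (\<lambda>x y. (x, y) \<in> R) (vs @ [w])"
  shows "set (zip vs (tl (vs @ [w]))) \<subseteq> R"
  using assms
proof (induction vs)
  case (Cons a vs)
  then show ?case by (cases vs) auto
qed simp

lemma cyclic_imp_graph_cycle:
  assumes cyc: "cyclic (\<lambda>x y. (x, y) \<in> parcs G) vs" and wf: "pair_wf_digraph G"
  obtains C where "graph_cycle G C" "cycle_verts C = set vs"
proof
  interpret pair_wf_digraph G by (rule wf)
  define w where "w = hd vs"
  define C where "C = zip vs (tl (vs @ [w]))"
  have ne: "vs \<noteq> []" using cyc by (auto simp: cyclic_def)
  have len: "length vs = length (tl (vs @ [w]))" by simp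
  have fstC: "map fst C = vs" and sndC: "map snd C = tl (vs @ [w])"
    unfolding C_def using len by simp_all
  have sub: "set C \<subseteq> parcs G"
    unfolding C_def using cyc ne
    by (intro successively_imp_zip_subset) (auto simp: cyclic_def successively_append_iff w_def)
  have cas: "pcas w C w"
    using pcas_zip[of vs w] ne unfolding C_def w_def by simp
  have "pawalk_verts w C = vs @ [w]"
    using fstC pawalk_verts_conv[OF cas] by simp
  then have "distinct (tl (pawalk_verts w C))"
    using cyc ne unfolding cyclic_def w_def by (cases vs) auto
  moreover have "length C = length vs" using fstC by (metis length_map)
  moreover have "w \<in> pverts G"
    using cyc wellformed'(2) unfolding cyclic_def w_def by auto
  ultimately show "graph_cycle G C"
    using cas sub cyc ne
    unfolding graph_cycle_def cyclic_def pre_digraph.cycle_def pre_digraph.awalk_def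
    by auto
  show "cycle_verts C = set vs"
    using fstC by (metis cycle_verts_def list.set_map)
qed

section \<open>From the forbidden subgraphs to claw-freeness, triangles and cycle extension\<close>

theorem theorem7:
  fixes G :: "'a pair_pre_digraph"
  assumes "pair_graph G"
    and "Digraph_Component.connected (with_proj G)"
    and "locally_connected G"
    and "induced_free {K113, K1_join_K1_union_P3} G"
    and "3 \<le> card (pverts G)"
  shows "fully_cycle_extendable G"
proof -
  interpret pair_graph G by (rule assms(1))
  let ?V = "pverts G"
  define E where "E = (\<lambda>x y. (x, y) \<in> parcs G)"
  have sym: "E y x" if "E x y" for x y
    using that graph_symmetric by (auto simp: E_def)
  have comm: "E x y \<longleftrightarrow> E y x" for x y
    using sym by blast
  have irr: "\<not> E x x" for x
    using no_loops' by (auto simp: E_def)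
  have EV: "x \<in> ?V" "y \<in> ?V" if "E x y" for x y
    using that wellformed' by (auto simp: E_def)
  have wf: "wf_digraph (with_proj G)" by unfold_locales
  have cross: "\<exists>x y. x \<in> S \<and> y \<notin> S \<and> E x y" if "a \<in> ?V" "b \<in> ?V" "a \<in> S" "b \<notin> S" for a b S
  proof -
    have "\<exists>e\<in>parcs G. fst e \<in> S \<and> snd e \<notin> S \<or> snd e \<in> S \<and> fst e \<notin> S"
      using connected_crossing_arc[OF assms(2), of a b S] that by simp
    then show ?thesis
      using sym by (fastforce simp: E_def)
  qed
  have local_cross: "\<exists>x y. E u x \<and> E u y \<and> x \<in> S \<and> y \<notin> S \<and> E x y"
    if "E u a" "E u b" "a \<in> S" "b \<notin> S" for u a b S
  proof -
    let ?N = "with_proj G \<restriction> neighborhood G u"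
    have "Digraph_Component.connected ?N"
      using assms(3) EV(1)[OF that(1)] by (auto simp: locally_connected_def)
    moreover have "a \<in> verts ?N" "b \<in> verts ?N"
      using that by (auto simp: E_def neighborhood_def)
    ultimately have "\<exists>e\<in>arcs ?N. fst e \<in> S \<and> snd e \<notin> S \<or> snd e \<in> S \<and> fst e \<notin> S"
      using connected_crossing_arc[of ?N a b S] that by (simp add: induce_subgraph_def)
    then show ?thesis
      using sym by (fastforce simp: E_def neighborhood_def induce_subgraph_def)
  qed
  have no_K113: False
    if "distinct [u, v, a, b, c]" "E u v" "\<forall>t\<in>{a, b, c}. E u t \<and> E v t"
      "\<not> E a b" "\<not> E a c" "\<not> E b c" for u v a b c
  proof -
    have "{u, v, a, b, c} \<subseteq> ?V" using that EV by auto
    then have "\<not> induced_free {K113, K1_join_K1_union_P3} G"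
      using that comm irr unfolding E_def by (intro K113_embedding[OF wf, of _ u v a b c]) auto
    then show False using assms(4) ..
  qed
  have no_K1P3: False
    if "distinct [u, c, a, v, b]" "\<forall>t\<in>{c, a, v, b}. E u t" "E a v" "E v b"
      "\<not> E a b" "\<not> E a c" "\<not> E b c" "\<not> E v c" for u v a b c
  proof -
    have "{u, c, a, v, b} \<subseteq> ?V" using that EV by auto
    then have "\<not> induced_free {K113, K1_join_K1_union_P3} G"
      using that comm irr unfolding E_def
      by (intro K1_join_K1_union_P3_embedding[OF wf, of _ u c a v b]) auto
    then show False using assms(4) ..
  qed
  interpret locally_connected_claw_free E
  proof unfold_locales
    fix u a b c
    assume nb: "E u a" "E u b" "E u c" and ne: "a \<noteq> b" "a \<noteq> c" "b \<noteq> c"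
    show "E a b \<or> E a c \<or> E b c"
    proof (rule ccontr)
      assume *: "\<not> ?thesis"
      \<comment> \<open>the vertices that may replace \<open>a\<close> in the independent triple\<close>
      define S where "S = {t. t \<noteq> b \<and> t \<noteq> c \<and> \<not> E t b \<and> \<not> E t c}"
      obtain x y where xy: "E u x" "E u y" "x \<in> S" "y \<notin> S" "E x y"
        using local_cross[OF nb(1,2), of S] * ne by (auto simp: S_def)
      \<comment> \<open>\<open>x\<close> lies in \<open>S\<close> and so is not adjacent to
        \<open>b\<close> or \<open>c\<close>; hence \<open>y\<close> is neither of them, and it
        fails to lie in \<open>S\<close> only by an adjacency.\<close>
      from xy have y: "y \<noteq> b" "y \<noteq> c" "E y b \<or> E y c"
        by (auto simp: S_def)
      have d: "distinct [u, x, y, b, c]"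
        using xy y nb ne irr by (auto simp: S_def)
      have n: "\<not> E x b" "\<not> E x c" "\<not> E b c" "\<not> E c b"
        using xy * comm by (auto simp: S_def)
      \<comment> \<open>Now \<open>x\<close>, \<open>b\<close>, \<open>c\<close> are independent and
        \<open>y\<close> is adjacent to \<open>x\<close>. Adjacent to both \<open>b\<close> and
        \<open>c\<close>, it yields \<open>K113\<close> with \<open>u\<close>; adjacent to just one,
        it is the middle of the path in the other graph.\<close>
      have "E y b \<and> E y c \<Longrightarrow> False"
        using no_K113[of u y x b c] d n xy nb comm by auto
      moreover have "E y b \<and> \<not> E y c \<Longrightarrow> False"
        using no_K1P3[of u c x y b] d n xy nb by auto
      moreover have "E y c \<and> \<not> E y b \<Longrightarrow> False"
        using no_K1P3[of u b x y c] d n xy nb by auto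
      ultimately show False using y by blast
    qed
  qed (use sym irr local_cross in auto)
  have fin: "finite ?V" by (rule pair_finite_verts)
  have other: "\<exists>w\<in>?V. w \<notin> T" if "card T < 3" "T \<subseteq> ?V" for T
    using that assms(5) by (metis linorder_not_less subsetI subset_antisym)
  show ?thesis unfolding fully_cycle_extendable_def
  proof (intro conjI ballI allI impI)
    fix u assume u: "u \<in> ?V"
    have c1: "card {u} < 3" by simp
    obtain w where w: "w \<in> ?V" "w \<noteq> u" using other[OF c1] u by auto
    obtain x where x: "E u x" using cross[OF u w(1), of "{u}"] w by auto
    have c2: "card {u, x} < 3" by (cases "u = x") auto
    obtain w' where w': "w' \<in> ?V" "w' \<notin> {u, x}" using other[OF c2] u EV[OF x] by auto
    obtain p q where pq: "p \<in> {u, x}" "q \<notin> {u, x}" "E p q"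
      using cross[OF u w'(1), of "{u, x}"] w' by auto
    \<comment> \<open>The end \<open>p\<close> of the edge \<open>ux\<close> has the further
      neighbor \<open>q\<close>, so in the connected neighborhood of \<open>p\<close> the other end
      has a neighbor, which completes a triangle.\<close>
    have "\<exists>y. E u y \<and> E x y"
    proof (cases "p = u")
      case True
      then obtain s t where "E u s" "E u t" "s \<in> {x}" "t \<notin> {x}" "E s t"
        using local_cross[of u x q "{x}"] x pq by auto
      then show ?thesis by auto
    next
      case False
      then obtain s t where "E x s" "E x t" "s \<in> {u}" "t \<notin> {u}" "E s t"
        using local_cross[of x u q "{u}"] x pq comm by auto
      then show ?thesis by auto
    qed
    then obtain y where y: "E u y" "E x y" by blast
    then have "distinct [u, x, y]" using x irr by auto
    then have "cyclic E [u, x, y]"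
      using x y comm by (auto simp: cyclic_def)
    then obtain C where "graph_cycle G C" "cycle_verts C = set [u, x, y]"
      using cyclic_imp_graph_cycle pair_wf_digraph unfolding E_def by blast
    then show "\<exists>T. graph_cycle G T \<and> card (cycle_verts T) = 3 \<and> u \<in> cycle_verts T"
      using \<open>distinct [u, x, y]\<close> by (intro exI[of _ C]) auto
  next
    fix C assume C: "graph_cycle G C \<and> card (cycle_verts C) < card ?V"
    let ?vs = "map fst C"
    have cyc: "cyclic E ?vs"
      using graph_cycle_imp_cyclic C unfolding E_def by blast
    have CV: "set ?vs = cycle_verts C" by (simp add: cycle_verts_def)
    have sub: "set ?vs \<subseteq> ?V" using cyclic_subset[OF EV(1) cyc] .
    obtain a where a: "a \<in> set ?vs" using cyc by (cases C) (auto simp: cyclic_def)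
    obtain b where b: "b \<in> ?V" "b \<notin> set ?vs"
      using C sub CV by (metis less_irrefl subsetI subset_antisym)
    obtain u x where "u \<in> set ?vs" "x \<notin> set ?vs" "E u x"
      using cross[of a b "set ?vs"] a b sub by blast
    then have "extends E (set ?vs)" using cyclic_extends[OF cyc] by blast
    then obtain ws where ws: "cyclic E ws" "card (set ws) = Suc (card (set ?vs))" "set ?vs \<subseteq> set ws"
      unfolding extends_def by blast
    then obtain C' where "graph_cycle G C'" "cycle_verts C' = set ws"
      using cyclic_imp_graph_cycle pair_wf_digraph unfolding E_def by blast
    then show "extendable G C"
      using ws CV unfolding extendable_def by (intro exI[of _ C']) auto
  qed
qed

end
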